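(* Let $\mathcal{C}$ be a category and $A\in\mathcal{C}$ an object such that: (i) every arrow $Y\to X$ in $\mathcal{C}$ is a strict epimorphism; (ii) for every $X\in\mathcal{C}$ there exists an arrow $A\to X$; (iii) the representable functor $F=[A,-]:\mathcal{C}\to\mathcal{E}ns$ preserves strict epimorphisms. Then for every object $X\in\mathcal{C}$ the action of the group $Aut(A)^{op}$ on the set $[A,X]$ is transitive.
   Context: $\mathcal{E}ns$ is the category of sets, $[A,X]$ is the set of arrows $A\to X$, and $Aut(A)^{op}$ acts on $[A,X]$ by precomposition. An arrow $f:X\to Y$ is a strict epimorphism if for every arrow $g:X\to Z$ such that, for all $C$ and all $x,y:C\to X$, $fx=fy$ implies $gx=gy$, there is a unique $h:Y\to Z$ with $g=hf$. (In $\mathcal{E}ns$ strict epimorphisms are the surjections.) *)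

theory Defs
  imports "HOL-Algebra.Group_Action"
begin

section \<open>Categories and functors\<close>

text \<open>
  Hom-sets belonging to different pairs of objects need not be disjoint, so composition and
  everything said about an arrow carry its domain and codomain explicitly:
  \<open>Comp C X Y Z g f\<close> is the composite of \<open>f : X \<rightarrow> Y\<close> and \<open>g : Y \<rightarrow> Z\<close>.
\<close>

record ('o, 'm) cat_struct =
  Obj :: "'o set"
  Hom :: "'o \<Rightarrow> 'o \<Rightarrow> 'm set"
  Comp :: "'o \<Rightarrow> 'o \<Rightarrow> 'o \<Rightarrow> 'm \<Rightarrow> 'm \<Rightarrow> 'm"
  Ident :: "'o \<Rightarrow> 'm"

locale category =
  fixes C :: "('o, 'm) cat_struct"
  assumes comp_closed:
      "\<lbrakk>X \<in> Obj C; Y \<in> Obj C; Z \<in> Obj C; f \<in> Hom C X Y; g \<in> Hom C Y Z\<rbrakk>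
        \<Longrightarrow> Comp C X Y Z g f \<in> Hom C X Z"
    and comp_assoc:
      "\<lbrakk>W \<in> Obj C; X \<in> Obj C; Y \<in> Obj C; Z \<in> Obj C;
        f \<in> Hom C W X; g \<in> Hom C X Y; h \<in> Hom C Y Z\<rbrakk>
        \<Longrightarrow> Comp C W X Z (Comp C X Y Z h g) f = Comp C W Y Z h (Comp C W X Y g f)"
    and ident_closed: "X \<in> Obj C \<Longrightarrow> Ident C X \<in> Hom C X X"
    and ident_right:
      "\<lbrakk>X \<in> Obj C; Y \<in> Obj C; f \<in> Hom C X Y\<rbrakk> \<Longrightarrow> Comp C X X Y f (Ident C X) = f"
    and ident_left:
      "\<lbrakk>X \<in> Obj C; Y \<in> Obj C; f \<in> Hom C X Y\<rbrakk> \<Longrightarrow> Comp C X Y Y (Ident C Y) f = f"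

definition strict_epi :: "('o, 'm) cat_struct \<Rightarrow> 'o \<Rightarrow> 'o \<Rightarrow> 'm \<Rightarrow> bool" where
  "strict_epi C X Y f \<longleftrightarrow>
     f \<in> Hom C X Y \<and>
     (\<forall>Z\<in>Obj C. \<forall>g\<in>Hom C X Z.
        (\<forall>W\<in>Obj C. \<forall>x\<in>Hom C W X. \<forall>y\<in>Hom C W X.
           Comp C W X Y f x = Comp C W X Y f y \<longrightarrow> Comp C W X Z g x = Comp C W X Z g y)
        \<longrightarrow> (\<exists>!h. h \<in> Hom C Y Z \<and> g = Comp C X Y Z h f))"

locale cat_functor = src: category C + tgt: category D
  for C :: "('o, 'm) cat_struct" and D :: "('p, 'n) cat_struct" +
  fixes Fo :: "'o \<Rightarrow> 'p"
    and Fa :: "'o \<Rightarrow> 'o \<Rightarrow> 'm \<Rightarrow> 'n"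
  assumes obj_closed: "X \<in> Obj C \<Longrightarrow> Fo X \<in> Obj D"
    and arr_closed:
      "\<lbrakk>X \<in> Obj C; Y \<in> Obj C; f \<in> Hom C X Y\<rbrakk> \<Longrightarrow> Fa X Y f \<in> Hom D (Fo X) (Fo Y)"
    and preserves_ident: "X \<in> Obj C \<Longrightarrow> Fa X X (Ident C X) = Ident D (Fo X)"
    and preserves_comp:
      "\<lbrakk>X \<in> Obj C; Y \<in> Obj C; Z \<in> Obj C; f \<in> Hom C X Y; g \<in> Hom C Y Z\<rbrakk>
        \<Longrightarrow> Fa X Z (Comp C X Y Z g f) = Comp D (Fo X) (Fo Y) (Fo Z) (Fa Y Z g) (Fa X Y f)"

definition preserves_strict_epis ::
  "('o, 'm) cat_struct \<Rightarrow> ('p, 'n) cat_struct \<Rightarrow> ('o \<Rightarrow> 'p) \<Rightarrow> ('o \<Rightarrow> 'o \<Rightarrow> 'm \<Rightarrow> 'n) \<Rightarrow> bool" where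
  "preserves_strict_epis C D Fo Fa \<longleftrightarrow>
     (\<forall>X\<in>Obj C. \<forall>Y\<in>Obj C. \<forall>f\<in>Hom C X Y.
        strict_epi C X Y f \<longrightarrow> strict_epi D (Fo X) (Fo Y) (Fa X Y f))"


section \<open>Sets and representable functors\<close>

text \<open>
  The category of all sets of elements of a type \<open>'u\<close>. Functions out of \<open>X\<close> are represented by
  their extensional versions, as in \<^theory>\<open>HOL-Library.FuncSet\<close>.
\<close>

definition Ens :: "('u set, 'u \<Rightarrow> 'u) cat_struct" where
  "Ens = \<lparr>Obj = UNIV,
          Hom = (\<lambda>X Y. X \<rightarrow>\<^sub>E Y),
          Comp = (\<lambda>X Y Z g f. compose X g f),
          Ident = (\<lambda>X. \<lambda>x\<in>X. x)\<rparr>"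

definition rep_arr :: "('o, 'm) cat_struct \<Rightarrow> 'o \<Rightarrow> 'o \<Rightarrow> 'o \<Rightarrow> 'm \<Rightarrow> 'm \<Rightarrow> 'm" where
  "rep_arr C A X Y f = (\<lambda>u\<in>Hom C A X. Comp C A X Y f u)"

lemma category_Ens: "category (Ens :: ('u set, 'u \<Rightarrow> 'u) cat_struct)"
proof
  fix X Y :: "'u set" and f assume f: "f \<in> Hom Ens X Y"
  show "Comp Ens X X Y f (Ident Ens X) = f" "Comp Ens X Y Y (Ident Ens Y) f = f"
    using f by (auto simp: Ens_def compose_def fun_eq_iff PiE_def extensional_def Pi_def)
qed (auto simp: Ens_def compose_def fun_eq_iff)

lemma (in category) cat_functor_rep:
  assumes "A \<in> Obj C"
  shows "cat_functor C Ens (Hom C A) (rep_arr C A)"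
proof -
  interpret E: category Ens by (rule category_Ens)
  show ?thesis
    by unfold_locales
      (use assms in \<open>auto simp: Ens_def rep_arr_def compose_def fun_eq_iff
         comp_closed comp_assoc ident_left\<close>)
qed

text \<open>
  The universe \<open>'u set\<close> is arbitrary: over every type, the strict epimorphisms are the surjections.
\<close>

lemma strict_epi_Ens_iff:
  "strict_epi Ens X Y f \<longleftrightarrow> f \<in> X \<rightarrow>\<^sub>E Y \<and> f ` X = Y" (is "?L = ?R")
proof
  assume L: ?L
  then have f: "f \<in> X \<rightarrow>\<^sub>E Y" by (auto simp: strict_epi_def Ens_def)
  have "Y \<subseteq> f ` X"
  proof (rule ccontr)
    assume "\<not> Y \<subseteq> f ` X"
    then obtain y where y: "y \<in> Y" "y \<notin> f ` X" by blast
    show False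
    proof (cases "X = {}")
      case True
      have e: "(\<lambda>x. undefined) \<in> X \<rightarrow>\<^sub>E {}" using True by auto
      from L e True y show False
        by (auto simp: strict_epi_def Ens_def compose_def dest!: spec[of _ "{}"] bspec[of _ _ "\<lambda>x. undefined"])
    next
      case False
      then obtain x where x: "x \<in> X" by blast
      let ?h1 = "\<lambda>z\<in>Y. z" and ?h2 = "\<lambda>z\<in>Y. if z = y then f x else z"
      from L f have ex: "\<exists>!h. h \<in> Y \<rightarrow>\<^sub>E Y \<and> f = compose X h f"
        by (auto simp: strict_epi_def Ens_def)
      have "?h1 \<in> Y \<rightarrow>\<^sub>E Y \<and> f = compose X ?h1 f"
        using f by (auto simp: compose_def fun_eq_iff PiE_def extensional_def Pi_def)
      moreover have "?h2 \<in> Y \<rightarrow>\<^sub>E Y \<and> f = compose X ?h2 f"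
        using f x y by (auto simp: compose_def fun_eq_iff PiE_def extensional_def Pi_def)
      ultimately have "?h1 = ?h2" using ex by blast
      then have "?h1 y = ?h2 y" by metis
      then have "y = f x" using y by simp
      then show False using x y by auto
    qed
  qed
  with f show ?R by auto
next
  assume R: ?R
  then have f: "f \<in> X \<rightarrow>\<^sub>E Y" and s: "f ` X = Y" by auto
  show ?L
    unfolding strict_epi_def Ens_def cat_struct.simps
  proof (intro conjI ballI impI, rule f)
    fix Z and g :: "'a \<Rightarrow> 'a"
    assume g: "g \<in> X \<rightarrow>\<^sub>E Z"
      and "\<forall>W\<in>(UNIV :: 'a set set). \<forall>x\<in>W \<rightarrow>\<^sub>E X. \<forall>y\<in>W \<rightarrow>\<^sub>E X.
        compose W f x = compose W f y \<longrightarrow> compose W g x = compose W g y"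
    note c = this(2)[THEN bspec, OF UNIV_I, THEN bspec, THEN bspec, THEN mp]
    have k: "g x = g y" if "x \<in> X" "y \<in> X" "f x = f y" for x y
    proof -
      let ?x = "\<lambda>z\<in>{x}. x" and ?y = "\<lambda>z\<in>{x}. y"
      have "compose {x} g ?x = compose {x} g ?y"
      proof (rule c)
        show "?x \<in> {x} \<rightarrow>\<^sub>E X" "?y \<in> {x} \<rightarrow>\<^sub>E X" using that by simp_all
        show "compose {x} f ?x = compose {x} f ?y"
          unfolding compose_def by (rule restrict_ext) (use that in simp)
      qed
      from fun_cong[OF this, of x] show ?thesis by (simp add: compose_def)
    qed
    define h where "h = (\<lambda>y\<in>Y. g (inv_into X f y))"
    have hf: "h (f x) = g x" if "x \<in> X" for x
    proof -
      have "f x \<in> f ` X" using that by simp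
      then have "g (inv_into X f (f x)) = g x"
        using that by (intro k) (simp_all add: inv_into_into f_inv_into_f)
      then show ?thesis using that s by (auto simp: h_def)
    qed
    show "\<exists>!h. h \<in> Y \<rightarrow>\<^sub>E Z \<and> g = compose X h f"
    proof (rule ex1I[of _ h])
      have "h y \<in> Z" if "y \<in> Y" for y
        using that g s hf by auto
      then have "h \<in> Y \<rightarrow>\<^sub>E Z" by (auto simp: h_def)
      moreover have "g = compose X h f"
        by (rule extensionalityI[of _ X]) (use g hf in \<open>auto simp: compose_def PiE_def\<close>)
      ultimately show "h \<in> Y \<rightarrow>\<^sub>E Z \<and> g = compose X h f" by blast
      fix h' assume h': "h' \<in> Y \<rightarrow>\<^sub>E Z \<and> g = compose X h' f"
      have "h' y = h y" for y
      proof (cases "y \<in> Y")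
        case True
        then obtain x where "x \<in> X" "y = f x" using s by auto
        then show ?thesis using h' hf[of x] by (metis compose_eq)
      next
        case False
        then show ?thesis using h' by (auto simp: h_def PiE_def extensional_def)
      qed
      then show "h' = h" by auto
    qed
  qed
qed


section \<open>Automorphisms and their action\<close>

definition End_monoid :: "('o, 'm) cat_struct \<Rightarrow> 'o \<Rightarrow> 'm monoid" where
  "End_monoid C A = \<lparr>carrier = Hom C A A, mult = Comp C A A A, one = Ident C A\<rparr>"

definition Aut_group :: "('o, 'm) cat_struct \<Rightarrow> 'o \<Rightarrow> 'm monoid" where
  "Aut_group C A = units_of (End_monoid C A)"

definition opposite :: "'g monoid \<Rightarrow> 'g monoid" where
  "opposite G = \<lparr>carrier = carrier G, mult = (\<lambda>x y. y \<otimes>\<^bsub>G\<^esub> x), one = \<one>\<^bsub>G\<^esub>\<rparr>"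

text \<open>
  Precomposition is a left action of the opposite group; it is extended by \<open>undefined\<close> outside
  the hom-set, as \<^const>\<open>BijGroup\<close> requires.
\<close>

definition precomp_action :: "('o, 'm) cat_struct \<Rightarrow> 'o \<Rightarrow> 'o \<Rightarrow> 'm \<Rightarrow> 'm \<Rightarrow> 'm" where
  "precomp_action C A X a = (\<lambda>u\<in>Hom C A X. Comp C A A X u a)"

end

theory Submission
  imports Defs
begin

text \<open>
  Every arrow out of \<open>A\<close> is a strict epimorphism, and \<open>[A,-]\<close> turns it into a surjection. So any
  \<open>v : A \<rightarrow> X\<close> factors as \<open>v = u \<circ> a\<close> through any other \<open>u : A \<rightarrow> X\<close>, with \<open>a\<close> an endomorphism of
  \<open>A\<close> (lemma \<open>factor_through\<close>). It remains to see that \<open>a\<close> is invertible, and in fact the same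
  factorisation makes every endomorphism so: factoring \<open>1\<^sub>A\<close> through it shows that each element of
  the monoid \<open>[A,A]\<close> has a right inverse, and a monoid with this property is a group (lemma
  \<open>endomorphism_invertible\<close>). Hence \<open>Aut(A) = [A,A]\<close>, and the \<open>Aut(A)\<close>-orbit of \<open>u\<close> is all of
  \<open>[A,X]\<close>.
\<close>

lemma (in category) monoid_End:
  assumes "A \<in> Obj C"
  shows "monoid (End_monoid C A)"
  using assms
  by unfold_locales
    (auto simp: End_monoid_def comp_closed comp_assoc ident_closed ident_left ident_right)

lemma group_opposite:
  assumes "group G"
  shows "group (opposite G)"
proof -
  interpret group G by (rule assms)
  show ?thesis
  proof (rule groupI)
    fix x assume "x \<in> carrier (opposite G)"
    then show "\<exists>y\<in>carrier (opposite G). y \<otimes>\<^bsub>opposite G\<^esub> x = \<one>\<^bsub>opposite G\<^esub>"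
      by (intro bexI[of _ "inv\<^bsub>G\<^esub> x"]) (auto simp: opposite_def)
  qed (auto simp: opposite_def m_assoc)
qed

lemma (in category) group_opposite_Aut:
  assumes "A \<in> Obj C"
  shows "group (opposite (Aut_group C A))"
  unfolding Aut_group_def
  by (intro group_opposite monoid.units_group monoid_End assms)

text \<open>
  Precomposing with an automorphism is bijective because precomposing with its inverse undoes it.
  Precomposition reverses the order of composition, which is why the opposite group acts.
\<close>

lemma (in category) group_action_precomp:
  assumes A: "A \<in> Obj C" and X: "X \<in> Obj C"
  shows "group_action (opposite (Aut_group C A)) (Hom C A X) (precomp_action C A X)"
proof -
  let ?G = "opposite (Aut_group C A)" and ?act = "precomp_action C A X"
  have carr: "carrier ?G = {a \<in> Hom C A A. \<exists>b\<in>Hom C A A.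
      Comp C A A A b a = Ident C A \<and> Comp C A A A a b = Ident C A}"
    by (auto simp: opposite_def Aut_group_def units_of_def Units_def End_monoid_def)
  have mult: "a \<otimes>\<^bsub>?G\<^esub> b = Comp C A A A b a" for a b
    by (simp add: opposite_def Aut_group_def units_of_def End_monoid_def)
  have act: "?act a \<in> Hom C A X \<rightarrow>\<^sub>E Hom C A X" if "a \<in> Hom C A A" for a
    using that A X by (auto simp: precomp_action_def comp_closed)
  have cancel: "?act b (?act a u) = u"
    if "u \<in> Hom C A X" "a \<in> Hom C A A" "b \<in> Hom C A A" "Comp C A A A a b = Ident C A" for a b u
    using that A X by (simp add: precomp_action_def comp_closed comp_assoc ident_right)
  have bij: "?act a \<in> Bij (Hom C A X)" if a: "a \<in> carrier ?G" for a
  proof -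
    obtain b where b: "a \<in> Hom C A A" "b \<in> Hom C A A"
      "Comp C A A A b a = Ident C A" "Comp C A A A a b = Ident C A"
      using a carr by auto
    have "bij_betw (?act a) (Hom C A X) (Hom C A X)"
      by (rule bij_betw_byWitness[of _ "?act b"]) (use b act cancel in \<open>auto simp: PiE_iff\<close>)
    then show ?thesis using act b by (auto simp: Bij_def PiE_def)
  qed
  have "?act (a \<otimes>\<^bsub>?G\<^esub> b) = ?act a \<otimes>\<^bsub>BijGroup (Hom C A X)\<^esub> ?act b"
    if "a \<in> carrier ?G" "b \<in> carrier ?G" for a b
  proof -
    have "a \<in> Hom C A A" "b \<in> Hom C A A" using that carr by auto
    then have "?act (a \<otimes>\<^bsub>?G\<^esub> b) = compose (Hom C A X) (?act a) (?act b)"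
      using A X
      by (auto simp: mult precomp_action_def compose_def fun_eq_iff comp_closed comp_assoc)
    then show ?thesis using that bij by (simp add: BijGroup_def)
  qed
  moreover have "?act a \<in> carrier (BijGroup (Hom C A X))" if "a \<in> carrier ?G" for a
    using bij[OF that] by (simp add: BijGroup_def)
  ultimately show ?thesis
    unfolding group_action_def
    by (intro group_hom.intro group_hom_axioms.intro homI group_opposite_Aut group_BijGroup A)
qed

text \<open>Surjectivity of \<open>[A,u] : [A,Y] \<rightarrow> [A,X]\<close>, read as a lifting property of \<open>A\<close>.\<close>

lemma factor_through:
  assumes "preserves_strict_epis C Ens (Hom C A) (rep_arr C A)"
    and "Y \<in> Obj C" "X \<in> Obj C" "strict_epi C Y X u" "v \<in> Hom C A X"
  obtains a where "a \<in> Hom C A Y" "Comp C A Y X u a = v"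
proof -
  have "u \<in> Hom C Y X" using assms(4) by (simp add: strict_epi_def)
  then have "strict_epi Ens (Hom C A Y) (Hom C A X) (rep_arr C A Y X u)"
    using assms by (auto simp: preserves_strict_epis_def)
  then have "rep_arr C A Y X u ` Hom C A Y = Hom C A X"
    by (simp add: strict_epi_Ens_iff)
  then show ?thesis using assms(5) that by (force simp: rep_arr_def)
qed

text \<open>
  The right inverse \<open>b\<close> of \<open>a\<close> has itself a right inverse \<open>c\<close>, and then
  \<open>c = (a \<circ> b) \<circ> c = a \<circ> (b \<circ> c) = a\<close>, so that \<open>b\<close> is a two-sided inverse.
\<close>

lemma (in category) endomorphism_invertible:
  assumes A: "A \<in> Obj C"
    and right_inv: "\<And>a. a \<in> Hom C A A \<Longrightarrow> \<exists>b\<in>Hom C A A. Comp C A A A a b = Ident C A"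
    and a: "a \<in> Hom C A A"
  shows "a \<in> carrier (Aut_group C A)"
proof -
  obtain b where b: "b \<in> Hom C A A" "Comp C A A A a b = Ident C A"
    using right_inv[OF a] by blast
  obtain c where c: "c \<in> Hom C A A" "Comp C A A A b c = Ident C A"
    using right_inv[OF b(1)] by blast
  have "c = Comp C A A A (Comp C A A A a b) c"
    using A b c by (simp add: ident_left)
  also have "\<dots> = Comp C A A A a (Comp C A A A b c)"
    using A a b(1) c(1) by (intro comp_assoc)
  also have "\<dots> = a"
    using A a c by (simp add: ident_right)
  finally show ?thesis
    using a b c by (auto simp: Aut_group_def units_of_def Units_def End_monoid_def)
qed

theorem theorem1p2:
  fixes C :: "('o, 'm) cat_struct" and A :: 'o
  assumes "category C"
    and "A \<in> Obj C"
    and "\<forall>X\<in>Obj C. \<forall>Y\<in>Obj C. \<forall>f\<in>Hom C Y X. strict_epi C Y X f"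
    and "\<forall>X\<in>Obj C. Hom C A X \<noteq> {}"
    and "preserves_strict_epis C Ens (Hom C A) (rep_arr C A)"
  shows "\<forall>X\<in>Obj C.
    transitive_action (opposite (Aut_group C A)) (Hom C A X) (precomp_action C A X)"
proof
  fix X assume X: "X \<in> Obj C"
  interpret category C by (rule assms(1))
  note A = assms(2)
  have factor: "\<exists>a\<in>Hom C A A. Comp C A A Y u a = v"
    if "Y \<in> Obj C" "u \<in> Hom C A Y" "v \<in> Hom C A Y" for Y u v
    using factor_through[OF assms(5) A that(1) _ that(3), of u] assms(3) A that by blast
  have Aut: "a \<in> carrier (Aut_group C A)" if "a \<in> Hom C A A" for a
    using A _ that
    by (rule endomorphism_invertible) (use factor A ident_closed in blast)
  have "\<exists>a\<in>carrier (opposite (Aut_group C A)). precomp_action C A X a u = v"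
    if "u \<in> Hom C A X" "v \<in> Hom C A X" for u v
    using factor[OF X that] Aut that by (auto simp: opposite_def precomp_action_def)
  then show "transitive_action (opposite (Aut_group C A)) (Hom C A X) (precomp_action C A X)"
    by (intro transitive_action.intro transitive_action_axioms.intro group_action_precomp A X)
qed

end
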